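(* Let $\alpha,\beta\in\mathbb{R}$ be such that $1,\alpha,\beta$ are linearly independent over $\mathbb{Q}$, let $(t_n)_{n=1}^\infty$ be an $\alpha\beta$-orbit, and let $J\subseteq\mathbb{N}$ satisfy $\underline{d}(J)=0$. Then $\underline{\dim}_B\{t_n\mid n\in\mathbb{N}\setminus J\}\geq 1/2$.
   Context: An (infinite) $\alpha\beta$-orbit is a sequence $(t_n)_{n=1}^\infty\subseteq\mathbb{R}/\mathbb{Z}$ with $t_{n+1}-t_n\in\{\alpha,\beta\}$ (mod $1$) for all $n$. For $J\subseteq\mathbb{N}$ the lower density is $\underline{d}(J)=\liminf_{N\to\infty}\frac1N|J\cap\{1,\ldots,N\}|$. For a set $E$, let $N(E,\rho)$ be the minimal number of intervals of length $\rho$ needed to cover $E$; the lower box dimension is $\underline{\dim}_B E=\liminf_{\rho\searrow 0}\frac{\log N(E,\rho)}{\log(1/\rho)}$. *)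

theory Defs
  imports "HOL-Analysis.Analysis"
begin

text \<open>The additive group \<open>\<real>/\<int>\<close>.\<close>

quotient_type circle = real / "\<lambda>x y :: real. x - y \<in> \<int>"
proof (rule equivpI)
  show "reflp (\<lambda>x y :: real. x - y \<in> \<int>)"
    by (simp add: reflp_def)
  show "symp (\<lambda>x y :: real. x - y \<in> \<int>)"
    using Ints_minus by (fastforce intro: sympI)
  show "transp (\<lambda>x y :: real. x - y \<in> \<int>)"
  proof (rule transpI)
    fix x y z :: real
    assume "x - y \<in> \<int>" "y - z \<in> \<int>"
    then have "(x - y) + (y - z) \<in> \<int>"
      by (rule Ints_add)
    then show "x - z \<in> \<int>"
      by simp
  qed
qed

lift_definition to_circle :: "real \<Rightarrow> circle" is "\<lambda>x. x" .

instantiation circle :: ab_group_add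
begin

lift_definition zero_circle :: circle is 0 .

lift_definition plus_circle :: "circle \<Rightarrow> circle \<Rightarrow> circle" is "(+)"
proof -
  fix a b c d :: real
  assume "a - b \<in> \<int>" "c - d \<in> \<int>"
  then have "(a - b) + (c - d) \<in> \<int>"
    by (rule Ints_add)
  then show "a + c - (b + d) \<in> \<int>"
    by (simp add: algebra_simps)
qed

lift_definition minus_circle :: "circle \<Rightarrow> circle \<Rightarrow> circle" is "(-)"
proof -
  fix a b c d :: real
  assume "a - b \<in> \<int>" "c - d \<in> \<int>"
  then have "(a - b) - (c - d) \<in> \<int>"
    by (rule Ints_diff)
  then show "a - c - (b - d) \<in> \<int>"
    by (simp add: algebra_simps)
qed

lift_definition uminus_circle :: "circle \<Rightarrow> circle" is uminus
proof -
  fix a b :: real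
  assume "a - b \<in> \<int>"
  then have "- (a - b) \<in> \<int>"
    by (rule Ints_minus)
  then show "- a - - b \<in> \<int>"
    by simp
qed

instance
  by standard (transfer; simp add: algebra_simps)+

end

lemma to_circle_eq_iff: "to_circle x = to_circle y \<longleftrightarrow> x - y \<in> \<int>"
  by transfer simp

text \<open>Sequences are indexed from \<open>1\<close>; the value \<open>t 0\<close> plays no role.\<close>

definition ab_orbit :: "real \<Rightarrow> real \<Rightarrow> (nat \<Rightarrow> circle) \<Rightarrow> bool" where
  "ab_orbit \<alpha> \<beta> t \<longleftrightarrow> (\<forall>n\<ge>1. t (Suc n) - t n \<in> {to_circle \<alpha>, to_circle \<beta>})"

definition lower_density :: "nat set \<Rightarrow> ereal" where
  "lower_density J = liminf (\<lambda>N. ereal (real (card (J \<inter> {1..N})) / real N))"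

text \<open>A closed interval of length \<open>\<rho>\<close> in \<open>\<real>/\<int>\<close>; it is the whole circle if \<open>\<rho> \<ge> 1\<close>.\<close>

definition circle_interval :: "real \<Rightarrow> real \<Rightarrow> circle set" where
  "circle_interval a \<rho> = to_circle ` {a..a + \<rho>}"

definition covering_number :: "circle set \<Rightarrow> real \<Rightarrow> nat" where
  "covering_number E \<rho> =
     (LEAST k. \<exists>C. finite C \<and> card C = k \<and> C \<subseteq> range (\<lambda>a. circle_interval a \<rho>) \<and> E \<subseteq> \<Union>C)"

text \<open>For nonempty \<open>E\<close> and \<open>\<rho> > 0\<close> the covering number is positive, so the convention
  \<open>ln 0 = 0\<close> only affects \<open>E = {}\<close>.\<close>

definition lower_box_dim :: "circle set \<Rightarrow> ereal" where
  "lower_box_dim E =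
     Liminf (at_right 0) (\<lambda>\<rho>. ereal (ln (real (covering_number E \<rho>)) / ln (1 / \<rho>)))"

lemma covering_number_witness:
  assumes "\<rho> > 0"
  shows "\<exists>C. finite C \<and> card C = covering_number E \<rho> \<and>
           C \<subseteq> range (\<lambda>a. circle_interval a \<rho>) \<and> E \<subseteq> \<Union>C"
proof -
  obtain m :: nat where m: "1 / \<rho> < real m"
    using reals_Archimedean2 by blast
  let ?C = "(\<lambda>i. circle_interval (real i * \<rho>) \<rho>) ` {..m}"
  have "x \<in> \<Union>?C" for x
  proof -
    obtain y where x: "x = to_circle y"
      by (metis Quotient3_abs_rep Quotient3_circle to_circle.abs_eq)
    define i where "i = nat \<lfloor>frac y / \<rho>\<rfloor>"
    have nonneg: "0 \<le> frac y / \<rho>"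
      using assms by (simp add: frac_ge_0)
    have i: "real i \<le> frac y / \<rho>" "frac y / \<rho> < real i + 1"
      unfolding i_def using nonneg by (simp_all add: floor_less_cancel)
    have "frac y / \<rho> \<le> 1 / \<rho>"
      using assms frac_lt_1[of y] by (simp add: divide_right_mono)
    then have "i \<le> m"
      using i(1) m by linarith
    moreover have "frac y \<in> {real i * \<rho>..real i * \<rho> + \<rho>}"
      using i assms by (simp add: field_simps)
    moreover have "x = to_circle (frac y)"
      by (simp add: x to_circle_eq_iff frac_def)
    ultimately have "i \<le> m" "x \<in> circle_interval (real i * \<rho>) \<rho>"
      unfolding circle_interval_def by blast+
    then show ?thesis
      by blast
  qed
  then have "\<exists>k C. finite C \<and> card C = k \<and> C \<subseteq> range (\<lambda>a. circle_interval a \<rho>) \<and> E \<subseteq> \<Union>C"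
    by (intro exI[of _ "card ?C"] exI[of _ ?C]) auto
  then show ?thesis
    unfolding covering_number_def by (rule LeastI_ex)
qed

end

theory Submission
  imports Defs
begin

text \<open>
  Since \<open>J\<close> has lower density \<open>0\<close>, its complement contains arbitrarily long blocks, and by compactness
  there is an infinite word whose prefixes all occur along such blocks. With \<open>i n\<close> the number of
  letters \<open>\<alpha>\<close> among the first \<open>n\<close> and \<open>\<gamma> = \<alpha> - \<beta>\<close>, every finite part of the sequence
  \<open>x n = n \<beta> + i n \<gamma>\<close> thus has a translate inside \<open>E = {t n | n \<notin> J}\<close>. It suffices that, for small
  \<open>\<rho>\<close>, the differences \<open>x p - x q\<close>, up to boundedly many translations, are \<open>\<rho>\<close>-dense modulo \<open>1\<close> in a
  fixed interval: pairs of covering intervals then number at least a constant times \<open>1 / \<rho>\<close>.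

  If the numbers of letters \<open>\<alpha>\<close> in factors of equal length differ unboundedly, a discrete
  intermediate value argument produces differences \<open>m \<beta> + (h + r) \<gamma>\<close> for arbitrarily long ranges of
  \<open>r\<close>, and \<open>\<gamma>\<close> is irrational. Otherwise \<open>i n = n \<theta> + O(1)\<close> for some \<open>\<theta>\<close>, and the differences are, up
  to bounded multiples of \<open>\<gamma>\<close>, all \<open>n \<beta> + j \<gamma>\<close> with \<open>(n, j)\<close> in a strip around the line of slope \<open>\<theta>\<close>.
  The vectors \<open>(n \<beta> + j \<gamma> + l, j - n \<theta>)\<close> form a subgroup of the plane with arbitrarily small elements
  of nonzero first coordinate. Small elements that are not all parallel approximate every \<open>(y, 0)\<close>;
  if they are all parallel, their multiples fill an initial interval before leaving the strip.
\<close>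

section \<open>Approximation modulo 1\<close>

text \<open>Distance in \<real>/\<int> is measured on real representatives, since
  \<open>circle\<close> carries only its group structure.\<close>

definition close_mod1 :: "real \<Rightarrow> real \<Rightarrow> real \<Rightarrow> bool" where
  "close_mod1 e x y \<longleftrightarrow> (\<exists>l::int. \<bar>x - y - of_int l\<bar> \<le> e)"

lemma close_mod1_sym: "close_mod1 e x y \<Longrightarrow> close_mod1 e y x"
proof -
  assume "close_mod1 e x y"
  then obtain l :: int where "\<bar>x - y - of_int l\<bar> \<le> e"
    by (auto simp: close_mod1_def)
  then have "\<bar>y - x - of_int (- l)\<bar> \<le> e"
    by simp
  then show ?thesis
    unfolding close_mod1_def by blast
qed

lemma close_mod1_add:
  assumes "close_mod1 d x y" "close_mod1 e x' y'"
  shows "close_mod1 (d + e) (x + x') (y + y')"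
proof -
  obtain l l' :: int where "\<bar>x - y - of_int l\<bar> \<le> d" "\<bar>x' - y' - of_int l'\<bar> \<le> e"
    using assms by (auto simp: close_mod1_def)
  then have "\<bar>x + x' - (y + y') - of_int (l + l')\<bar> \<le> d + e"
    by simp
  then show ?thesis
    unfolding close_mod1_def by blast
qed

lemma close_mod1_trans:
  assumes "close_mod1 d x y" "close_mod1 e y z"
  shows "close_mod1 (d + e) x z"
proof -
  obtain l l' :: int where "\<bar>x - y - of_int l\<bar> \<le> d" "\<bar>y - z - of_int l'\<bar> \<le> e"
    using assms by (auto simp: close_mod1_def)
  then have "\<bar>x - z - of_int (l + l')\<bar> \<le> d + e"
    by simp
  then show ?thesis
    unfolding close_mod1_def by blast
qed

text \<open>Multiples of 5\<rho> are more than 4\<rho> apart, which is the total error in the later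
  pair count. As c \<le> 1/2 and 4\<rho> \<le> 2/5, the integer in \<open>close_mod1\<close> can
  only be 0.\<close>

lemma separated_grid:
  fixes c \<rho> :: real
  assumes c: "0 < c" "c \<le> 1 / 2" and \<rho>: "0 < \<rho>" "\<rho> \<le> 1 / 10"
  obtains Y where "finite Y" "Y \<subseteq> {0..c}" "c / (5 * \<rho>) \<le> card Y"
    "\<And>y y'. y \<in> Y \<Longrightarrow> y' \<in> Y \<Longrightarrow> close_mod1 (4 * \<rho>) y y' \<Longrightarrow> y = y'"
proof
  define M where "M = nat \<lfloor>c / (5 * \<rho>)\<rfloor>"
  define Y where "Y = (\<lambda>r. 5 * \<rho> * real r) ` {..M}"
  have M: "real M \<le> c / (5 * \<rho>)" "c / (5 * \<rho>) < real M + 1"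
    unfolding M_def using c \<rho> by (simp_all add: floor_less_cancel)
  show "finite Y"
    by (simp add: Y_def)
  show sub: "Y \<subseteq> {0..c}"
  proof
    fix y assume "y \<in> Y"
    then obtain r where r: "y = 5 * \<rho> * real r" "r \<le> M"
      by (auto simp: Y_def)
    then have "real r \<le> c / (5 * \<rho>)"
      using M by linarith
    then show "y \<in> {0..c}"
      using \<rho> r by (simp add: field_simps)
  qed
  have "card Y = card {..M}"
    unfolding Y_def using \<rho> by (intro card_image inj_onI) simp
  then show "c / (5 * \<rho>) \<le> card Y"
    using M by simp
  fix y y' assume y: "y \<in> Y" "y' \<in> Y" and "close_mod1 (4 * \<rho>) y y'"
  then obtain l :: int where l: "\<bar>y - y' - of_int l\<bar> \<le> 4 * \<rho>"
    by (auto simp: close_mod1_def)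
  have "y \<in> {0..c}" "y' \<in> {0..c}"
    using sub y by auto
  then have "\<bar>y - y'\<bar> \<le> 1 / 2"
    using c unfolding atLeastAtMost_iff by linarith
  then have "\<bar>real_of_int l\<bar> < 1"
    using l \<rho> by linarith
  then have "l = 0"
    by linarith
  obtain r r' where r: "y = 5 * \<rho> * real r" "y' = 5 * \<rho> * real r'"
    using y by (auto simp: Y_def)
  then have "\<rho> * (5 * \<bar>real r - real r'\<bar>) \<le> \<rho> * 4"
    using l \<open>l = 0\<close> \<rho> by (simp add: abs_mult flip: right_diff_distrib)
  then have "5 * \<bar>real r - real r'\<bar> \<le> 4"
    using \<rho> by (simp only: mult_le_cancel_left_pos)
  then have "real_of_int \<bar>int r - int r'\<bar> < 1"
    by simp
  then have "r = r'"
    by linarith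
  then show "y = y'"
    using r by simp
qed

section \<open>Limit words and long gaps in sets of lower density zero\<close>

text \<open>Compactness of the binary sequences, by nested infinite index sets \<open>A n\<close>:
  on \<open>A (Suc n)\<close> the entry at \<open>n\<close> is constant. The bound M \<ge> L serves
  the application, where the first M letters of \<open>u M\<close> are read along a gap of
  J.\<close>

lemma binary_sequences_cluster_point:
  fixes u :: "nat \<Rightarrow> nat \<Rightarrow> bool"
  obtains v where "\<And>L. \<exists>M\<ge>L. \<forall>j<L. u M j = v j"
proof -
  have step: "\<exists>B. infinite B \<and> B \<subseteq> A \<and> (\<exists>b. \<forall>M\<in>B. u M n = b)"
    if "infinite A" for A :: "nat set" and n
  proof -
    have "A = {M \<in> A. u M n} \<union> {M \<in> A. \<not> u M n}"
      by auto
    then have "infinite {M \<in> A. u M n} \<or> infinite {M \<in> A. \<not> u M n}"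
      by (metis finite_UnI that)
    then show ?thesis
      by (elim disjE) (rule exI, rule conjI, assumption, force)+
  qed
  have "\<exists>A. \<forall>n. infinite (A n) \<and>
      (A (Suc n) \<subseteq> A n \<and> (\<exists>b. \<forall>M\<in>A (Suc n). u M n = b))"
    by (rule dependent_nat_choice) (use step infinite_UNIV_nat in blast)+
  then obtain A where A: "\<And>n. infinite (A n)" "\<And>n. A (Suc n) \<subseteq> A n"
    "\<And>n. \<exists>b. \<forall>M\<in>A (Suc n). u M n = b"
    by blast
  then obtain v where v: "\<And>n M. M \<in> A (Suc n) \<Longrightarrow> u M n = v n"
    by metis
  show thesis
  proof
    fix L
    obtain M where "M \<in> A L" "M \<ge> L"
      using A(1)[of L] by (meson infinite_nat_iff_unbounded_le)
    moreover have "A L \<subseteq> A (Suc j)" if "j < L" for j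
      using lift_Suc_antimono_le[of A "Suc j" L] A(2) that by simp
    ultimately show "\<exists>M\<ge>L. \<forall>j<L. u M j = v j"
      using v by blast
  qed
qed

text \<open>If every window of length D = L + 1 met J, disjoint windows would give J positive lower
  density.\<close>

lemma lower_density_zero_gap:
  assumes "lower_density J = 0"
  obtains n where "n \<ge> 1" "{n..n + L} \<inter> J = {}"
proof (rule ccontr)
  assume "\<not> thesis"
  then have hit: "\<exists>j. j \<in> J \<and> n \<le> j \<and> j \<le> n + L" if "n \<ge> 1" for n
    using that \<open>\<And>n. 1 \<le> n \<Longrightarrow> {n..n + L} \<inter> J = {} \<Longrightarrow> thesis\<close> by fastforce
  define D where "D = Suc L"
  have "q \<le> card (J \<inter> {1..q * D})" for q
  proof (induction q)
    case (Suc q)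
    obtain j where j: "j \<in> J" "q * D + 1 \<le> j" "j \<le> q * D + 1 + L"
      using hit[of "q * D + 1"] by auto
    have "Suc q \<le> card (insert j (J \<inter> {1..q * D}))"
      using Suc j by simp
    also have "\<dots> \<le> card (J \<inter> {1..Suc q * D})"
      using j by (intro card_mono) (auto simp: D_def)
    finally show ?case .
  qed simp
  then have dens: "N div D \<le> card (J \<inter> {1..N})" for N
    by (rule order_trans[OF _ card_mono]) (auto intro: order_trans[OF _ div_times_less_eq_dividend])
  \<comment> \<open>The factor 2 absorbs the incomplete last window: N \<ge> D gives N < D (N div D)
    + D \<le> 2 D (N div D).\<close>
  have "ereal (1 / (2 * real D)) \<le> lower_density J"
    unfolding lower_density_def
  proof (rule Liminf_bounded, rule eventually_mono[OF eventually_ge_at_top[of D]])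
    fix N :: nat assume N: "D \<le> N"
    have "N < D * (N div D) + D"
      using dividend_less_div_times[of D N] by (simp add: D_def algebra_simps)
    moreover have "D * 1 \<le> D * (N div D)"
      using N by (intro mult_left_mono) (auto simp: D_def div_greater_zero_iff Suc_le_eq)
    moreover have "D * (N div D) \<le> D * card (J \<inter> {1..N})"
      using dens by (rule mult_le_mono2)
    ultimately have "N \<le> 2 * D * card (J \<inter> {1..N})"
      by linarith
    then have "real N \<le> 2 * real D * real (card (J \<inter> {1..N}))"
      by (metis of_nat_le_iff of_nat_mult of_nat_numeral)
    then show "ereal (1 / (2 * real D)) \<le> ereal (real (card (J \<inter> {1..N})) / real N)"
      using N by (simp add: D_def field_simps)
  qed
  then show False
    using assms by (simp add: D_def)
qed

section \<open>Slopes and density in a strip\<close>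

text \<open>Comparing \<open>a (m * n)\<close> with both \<open>m * a n\<close> and
  \<open>n * a m\<close> shows that the intervals from \<open>(a n - K) / n\<close> to
  \<open>(a n + K) / n\<close>, n \<ge> 1, meet pairwise. The supremum of their left endpoints then
  lies in all of them.\<close>

lemma quasi_additive_slope:
  fixes a :: "nat \<Rightarrow> real"
  assumes "\<And>m n. \<bar>a (m + n) - a m - a n\<bar> \<le> K"
  shows "\<exists>\<theta>::real. \<forall>n. \<bar>a n - n * \<theta>\<bar> \<le> K"
proof -
  have mult: "\<bar>a (m * n) - m * a n\<bar> \<le> (m - 1) * K" if "m \<ge> 1" for m n
    using that
  proof (induction m rule: dec_induct)
    case (step m)
    have "a (Suc m * n) - Suc m * a n = (a (n + m * n) - a n - a (m * n)) + (a (m * n) - m * a n)"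
      by (simp add: algebra_simps)
    then show ?case
      using assms[of n "m * n"] step by (simp add: left_diff_distrib)
  qed simp
  have K: "K \<ge> 0"
    using assms[of 0 0] by linarith
  have le: "(a n - K) / n \<le> (a m + K) / m" if "n \<ge> 1" "m \<ge> 1" for m n
  proof -
    have "m * a n - m * K \<le> n * a m + n * K"
      using mult[of m n] mult[of n m] that K by (simp add: mult.commute of_nat_diff algebra_simps abs_le_iff)
    then show ?thesis
      using that by (simp add: field_simps)
  qed
  define \<theta> where "\<theta> = (SUP n\<in>{1..}. (a n - K) / n)"
  have "(a n - K) / n \<le> \<theta>" if "n \<ge> 1" for n
    unfolding \<theta>_def using le[OF _ that] that
    by (intro cSUP_upper bdd_aboveI2[where M = "(a n + K) / n"]) auto
  moreover have "\<theta> \<le> (a n + K) / n" if "n \<ge> 1" for n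
    unfolding \<theta>_def using le[OF _ that] by (intro cSUP_least) auto
  ultimately have "\<bar>a n - n * \<theta>\<bar> \<le> K" if "n \<ge> 1" for n
    using that by (fastforce simp: field_simps abs_le_iff)
  moreover have "\<bar>a 0\<bar> \<le> K"
    using assms[of 0 0] by simp
  ultimately have "\<bar>a n - n * \<theta>\<bar> \<le> K" for n
    by (cases "n = 0") auto
  then show ?thesis
    by blast
qed

text \<open>Dirichlet approximation of \<theta> and \<beta> + \<theta>\<gamma> with a common
  denominator \<open>q\<close>: the numerators \<open>p 0\<close> and \<open>p 1\<close> supply j
  and -l, and the first coordinate is then at most (1 + |\<gamma>|)/N in absolute value.\<close>

lemma strip_small_vector:
  fixes \<beta> \<gamma> \<theta> \<epsilon> :: real
  assumes "\<epsilon> > 0"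
  obtains n j l :: int
  where "n > 0" "\<bar>n * \<beta> + j * \<gamma> + l\<bar> \<le> \<epsilon>" "\<bar>j - n * \<theta>\<bar> \<le> \<epsilon>"
proof -
  obtain N :: nat where N: "N > 0" "1 / N * (1 + \<bar>\<gamma>\<bar>) \<le> \<epsilon>"
  proof -
    obtain N :: nat where N: "(1 + \<bar>\<gamma>\<bar>) / \<epsilon> < N"
      using reals_Archimedean2 by blast
    then have "N > 0"
      using assms by (intro gr0I) (auto simp: divide_less_0_iff not_less field_simps)
    then show thesis
      using N assms by (intro that[of N]) (simp_all add: field_simps)
  qed
  define w where "w i = (if i = 0 then \<theta> else \<beta> + \<theta> * \<gamma>)" for i :: nat
  obtain q p where q: "0 < q" "\<And>i. i < 2 \<Longrightarrow> \<bar>of_int q * w i - of_int (p i)\<bar> < 1 / N"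
    using Dirichlet_approx_simult[OF N(1), of 2 w] by metis
  have 0: "\<bar>q * \<theta> - p 0\<bar> < 1 / N" and 1: "\<bar>q * (\<beta> + \<theta> * \<gamma>) - p 1\<bar> < 1 / N"
    using q(2)[of 0] q(2)[of 1] by (simp_all add: w_def)
  have pos: "0 \<le> 1 / real N * \<bar>\<gamma>\<bar>"
    by simp
  show thesis
  proof
    show "q > 0" by fact
    have "q * \<beta> + p 0 * \<gamma> + (- p 1) = (q * (\<beta> + \<theta> * \<gamma>) - p 1) - (q * \<theta> - p 0) * \<gamma>"
      by (simp add: algebra_simps)
    also have "\<bar>\<dots>\<bar> \<le> \<bar>q * (\<beta> + \<theta> * \<gamma>) - p 1\<bar> + \<bar>q * \<theta> - p 0\<bar> * \<bar>\<gamma>\<bar>"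
      by (metis abs_mult abs_triangle_ineq4)
    also have "\<dots> \<le> 1 / N + 1 / N * \<bar>\<gamma>\<bar>"
      using 0 1 by (intro add_mono mult_right_mono) auto
    also have "\<dots> \<le> \<epsilon>"
      using N by (simp add: algebra_simps add_divide_distrib)
    finally show "\<bar>q * \<beta> + p 0 * \<gamma> + (- p 1)\<bar> \<le> \<epsilon>"
      by simp
    show "\<bar>p 0 - q * \<theta>\<bar> \<le> \<epsilon>"
    proof -
      have "1 / N \<le> \<epsilon>"
        using N(2) pos unfolding distrib_left by linarith
      then show ?thesis
        using 0 by linarith
    qed
  qed
qed

text \<open>The point is that \<open>c\<close> does not depend on \<rho>. The hypothesis makes the
  first coordinate of the Dirichlet vectors nonzero, as these have n > 0.\<close>

lemma strip_dense:
  fixes \<beta> \<gamma> \<theta> :: real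
  assumes indep: "\<And>(n::int) (j::int) (l::int). of_int n * \<beta> + of_int j * \<gamma> + of_int l = 0 \<Longrightarrow> n = 0"
  shows "\<exists>c. 0 < c \<and> c \<le> 1 / 2 \<and> (\<forall>\<rho>>0. \<forall>y\<in>{0..c}.
    \<exists>(n::int) (j::int) (l::int). \<bar>n * \<beta> + j * \<gamma> + l - y\<bar> \<le> \<rho> \<and> \<bar>j - n * \<theta>\<bar> \<le> 1)"
proof -
  define \<Lambda> :: "(real \<times> real) set"
    where "\<Lambda> = range (\<lambda>(n::int, j::int, l::int). (n * \<beta> + j * \<gamma> + l, j - n * \<theta>))"
  have \<Lambda>I: "(n * \<beta> + j * \<gamma> + l, j - n * \<theta>) \<in> \<Lambda>" for n j l :: int
    unfolding \<Lambda>_def by (rule range_eqI[where x = "(n, j, l)"]) simp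
  have \<Lambda>E: "\<exists>(n::int) (j::int) (l::int). g = n * \<beta> + j * \<gamma> + l \<and> u = j - n * \<theta>" if "(g, u) \<in> \<Lambda>" for g u
    using that by (auto simp: \<Lambda>_def)
  have comb: "(of_int a * g + of_int b * g', of_int a * u + of_int b * u') \<in> \<Lambda>"
    if v: "(g, u) \<in> \<Lambda>" "(g', u') \<in> \<Lambda>" for a b :: int and g u g' u'
  proof -
    obtain n j l :: int where 1: "g = n * \<beta> + j * \<gamma> + l" "u = j - n * \<theta>"
      using \<Lambda>E[OF v(1)] by blast
    obtain n' j' l' :: int where 2: "g' = n' * \<beta> + j' * \<gamma> + l'" "u' = j' - n' * \<theta>"
      using \<Lambda>E[OF v(2)] by blast
    show ?thesis
      using \<Lambda>I[of "a * n + b * n'" "a * j + b * j'" "a * l + b * l'"]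
      unfolding 1 2 by (simp add: algebra_simps)
  qed
  have small: "\<exists>g u. (g, u) \<in> \<Lambda> \<and> g \<noteq> 0 \<and> \<bar>g\<bar> \<le> \<epsilon> \<and> \<bar>u\<bar> \<le> \<epsilon>" if \<epsilon>: "\<epsilon> > 0" for \<epsilon>
  proof -
    obtain n j l :: int
      where v: "n > 0" "\<bar>n * \<beta> + j * \<gamma> + l\<bar> \<le> \<epsilon>" "\<bar>j - n * \<theta>\<bar> \<le> \<epsilon>"
      using strip_small_vector[OF \<epsilon>] .
    then have "n * \<beta> + j * \<gamma> + l \<noteq> 0"
      using indep[of n j l] by auto
    then show ?thesis
      using \<Lambda>I v(2,3) by blast
  qed
  have "\<exists>c. 0 < c \<and> c \<le> 1 / 2 \<and>
    (\<forall>\<rho> y. \<rho> > 0 \<longrightarrow> y \<in> {0..c} \<longrightarrow> (\<exists>g u. (g, u) \<in> \<Lambda> \<and> \<bar>g - y\<bar> \<le> \<rho> \<and> \<bar>u\<bar> \<le> 1))"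
  proof (cases "\<forall>\<epsilon>>0. \<exists>g u g' u'. (g, u) \<in> \<Lambda> \<and> (g', u') \<in> \<Lambda> \<and> g * u' \<noteq> g' * u \<and>
      \<bar>g\<bar> \<le> \<epsilon> \<and> \<bar>u\<bar> \<le> \<epsilon> \<and> \<bar>g'\<bar> \<le> \<epsilon> \<and> \<bar>u'\<bar> \<le> \<epsilon>")
    case True
    have "\<exists>g u. (g, u) \<in> \<Lambda> \<and> \<bar>g - y\<bar> \<le> \<rho> \<and> \<bar>u\<bar> \<le> 1" if \<rho>: "\<rho> > 0" for \<rho> y
    proof -
      \<comment> \<open>Rounding the two coefficients changes each coordinate by at most
        2\<epsilon>: at most \<rho> in the first, at most 1 in the second.\<close>
      define \<epsilon> where "\<epsilon> = min (\<rho> / 2) (1 / 2)"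
      obtain g u g' u' where gu: "(g, u) \<in> \<Lambda>" "(g', u') \<in> \<Lambda>" "g * u' \<noteq> g' * u"
        "\<bar>g\<bar> \<le> \<epsilon>" "\<bar>u\<bar> \<le> \<epsilon>" "\<bar>g'\<bar> \<le> \<epsilon>" "\<bar>u'\<bar> \<le> \<epsilon>"
        using True[rule_format, of \<epsilon>] \<rho> by (auto simp: \<epsilon>_def)
      \<comment> \<open>Round the real solution of \<open>a (g, u) + b (g', u') = (y, 0)\<close> to integers.\<close>
      define d where "d = g * u' - g' * u"
      define a b where "a = y * u' / d" and "b = - (y * u / d)"
      have "d \<noteq> 0"
        using gu by (simp add: d_def)
      have y: "a * g + b * g' = y"
      proof -
        have "a * g + b * g' = y * d / d"
          by (simp add: a_def b_def d_def algebra_simps diff_divide_distrib)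
        then show ?thesis
          using \<open>d \<noteq> 0\<close> by simp
      qed
      have 0: "a * u + b * u' = 0"
        by (simp add: a_def b_def)
      have est: "\<bar>\<lfloor>a\<rfloor> * z + \<lfloor>b\<rfloor> * z' - (a * z + b * z')\<bar> \<le> 2 * \<epsilon>"
        if "\<bar>z\<bar> \<le> \<epsilon>" "\<bar>z'\<bar> \<le> \<epsilon>" for z z' :: real
      proof -
        have "\<lfloor>a\<rfloor> * z + \<lfloor>b\<rfloor> * z' - (a * z + b * z') = - (frac a * z) - frac b * z'"
          by (simp add: frac_def algebra_simps)
        moreover have "\<bar>frac a * z\<bar> \<le> 1 * \<epsilon>" "\<bar>frac b * z'\<bar> \<le> 1 * \<epsilon>"
          unfolding abs_mult using that frac_lt_1[of a] frac_lt_1[of b]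
          by (intro mult_mono; simp)+
        ultimately show ?thesis
          by linarith
      qed
      have "\<bar>\<lfloor>a\<rfloor> * g + \<lfloor>b\<rfloor> * g' - y\<bar> \<le> \<rho>" "\<bar>\<lfloor>a\<rfloor> * u + \<lfloor>b\<rfloor> * u'\<bar> \<le> 1"
        using est[of g g'] est[of u u'] gu y 0 by (simp_all add: \<epsilon>_def)
      then show ?thesis
        using comb[OF gu(1,2), of "\<lfloor>a\<rfloor>" "\<lfloor>b\<rfloor>"] by blast
    qed
    then show ?thesis
      by (intro exI[of _ "1/2"]) auto
  next
    case False
    then obtain \<epsilon>\<^sub>0 where \<epsilon>\<^sub>0: "\<epsilon>\<^sub>0 > 0"
      and par: "\<And>g u g' u'. (g, u) \<in> \<Lambda> \<Longrightarrow> (g', u') \<in> \<Lambda> \<Longrightarrow>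
        \<bar>g\<bar> \<le> \<epsilon>\<^sub>0 \<Longrightarrow> \<bar>u\<bar> \<le> \<epsilon>\<^sub>0 \<Longrightarrow> \<bar>g'\<bar> \<le> \<epsilon>\<^sub>0 \<Longrightarrow> \<bar>u'\<bar> \<le> \<epsilon>\<^sub>0 \<Longrightarrow> g * u' = g' * u"
      by blast
    obtain g\<^sub>0 u\<^sub>0 where v0: "(g\<^sub>0, u\<^sub>0) \<in> \<Lambda>" "g\<^sub>0 \<noteq> 0" "\<bar>g\<^sub>0\<bar> \<le> \<epsilon>\<^sub>0" "\<bar>u\<^sub>0\<bar> \<le> \<epsilon>\<^sub>0"
      using small[OF \<epsilon>\<^sub>0] by blast
    \<comment> \<open>Elements with both coordinates at most \<open>\<epsilon>\<^sub>0\<close> in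
      absolute value are parallel to \<open>(g\<^sub>0, u\<^sub>0)\<close>, so |u| = s |g| for them.
      The choice of \<open>c\<close> keeps multiples in the strip as long as their first coordinate
      is at most 2c in absolute value.\<close>
    define s where "s = \<bar>u\<^sub>0 / g\<^sub>0\<bar>"
    define c where "c = min (1 / 2) (1 / (2 * s + 2))"
    have s: "s \<ge> 0"
      by (simp add: s_def)
    then have c: "0 < c" "c \<le> 1 / 2" "s * (2 * c) \<le> 1"
    proof -
      show "0 < c" "c \<le> 1 / 2"
        using s by (auto simp: c_def)
      have "s * (2 * c) \<le> s * (2 * (1 / (2 * s + 2)))"
        using s by (intro mult_left_mono) (auto simp: c_def)
      also have "\<dots> \<le> 1"
        using s by (simp add: field_simps)
      finally show "s * (2 * c) \<le> 1" .
    qed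
    have "\<exists>g u. (g, u) \<in> \<Lambda> \<and> \<bar>g - y\<bar> \<le> \<rho> \<and> \<bar>u\<bar> \<le> 1" if \<rho>: "\<rho> > 0" and y: "y \<in> {0..c}" for \<rho> y
    proof -
      \<comment> \<open>The three bounds give parallelism, precision \<rho>, and |k g| \<le> y +
        \<epsilon> \<le> 2c.\<close>
      define \<epsilon> where "\<epsilon> = min \<epsilon>\<^sub>0 (min \<rho> c)"
      have "\<epsilon> > 0" "\<epsilon> \<le> \<epsilon>\<^sub>0" "\<epsilon> \<le> \<rho>" "\<epsilon> \<le> c"
        using \<epsilon>\<^sub>0 \<rho> c by (auto simp: \<epsilon>_def)
      moreover obtain g u where gu: "(g, u) \<in> \<Lambda>" "g \<noteq> 0" "\<bar>g\<bar> \<le> \<epsilon>" "\<bar>u\<bar> \<le> \<epsilon>"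
        using small[OF \<open>\<epsilon> > 0\<close>] by blast
      ultimately have "g * u\<^sub>0 = g\<^sub>0 * u"
        using par[OF gu(1) v0(1)] v0 by linarith
      then have "\<bar>u\<bar> = s * \<bar>g\<bar>"
        using v0(2) by (simp add: s_def field_simps flip: abs_mult)
      define k where "k = \<lfloor>y / g\<rfloor>"
      have "\<bar>k * g - y\<bar> = \<bar>k - y / g\<bar> * \<bar>g\<bar>"
        using gu by (simp add: left_diff_distrib flip: abs_mult)
      also have "\<dots> \<le> 1 * \<bar>g\<bar>"
        unfolding k_def by (intro mult_right_mono) linarith+
      finally have kg: "\<bar>k * g - y\<bar> \<le> \<epsilon>"
        using gu by simp
      then have "\<bar>k * g\<bar> \<le> 2 * c"
        using y \<open>\<epsilon> \<le> c\<close> unfolding atLeastAtMost_iff by linarith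
      then have "s * \<bar>k * g\<bar> \<le> s * (2 * c)"
        using s by (rule mult_left_mono)
      then have "\<bar>k * u\<bar> \<le> 1"
        using c \<open>\<bar>u\<bar> = s * \<bar>g\<bar>\<close> by (simp add: abs_mult algebra_simps)
      then show ?thesis
        using comb[OF gu(1) gu(1), of k 0] kg \<open>\<epsilon> \<le> \<rho>\<close> by force
    qed
    then show ?thesis
      using c by blast
  qed
  then obtain c where c: "0 < c" "c \<le> 1 / 2"
    and *: "\<And>\<rho> y. \<rho> > 0 \<Longrightarrow> y \<in> {0..c} \<Longrightarrow> \<exists>g u. (g, u) \<in> \<Lambda> \<and> \<bar>g - y\<bar> \<le> \<rho> \<and> \<bar>u\<bar> \<le> 1"
    by blast
  show ?thesis
  proof (intro exI[of _ c] conjI c allI impI ballI)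
    fix \<rho> y :: real assume "\<rho> > 0" "y \<in> {0..c}"
    then obtain g u where "(g, u) \<in> \<Lambda>" "\<bar>g - y\<bar> \<le> \<rho>" "\<bar>u\<bar> \<le> 1"
      using * by blast
    then show "\<exists>(n::int) (j::int) (l::int). \<bar>n * \<beta> + j * \<gamma> + l - y\<bar> \<le> \<rho> \<and> \<bar>j - n * \<theta>\<bar> \<le> 1"
      by (auto simp: \<Lambda>_def)
  qed
qed

section \<open>Dense differences in the unbalanced and balanced cases\<close>

text \<open>\<open>K\<close> is uniform in the target because only the finitely many points of an
  \<epsilon>/2-net \<open>S\<close> of the circle are approximated, each to within
  \<epsilon>/2.\<close>

lemma irrational_rotation_dense:
  fixes \<gamma> \<epsilon> :: real
  assumes "\<gamma> \<notin> \<rat>" "\<epsilon> > 0"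
  obtains K :: nat where "\<And>z. \<exists>r\<le>K. close_mod1 \<epsilon> (of_nat r * \<gamma>) z"
proof -
  have "\<exists>r::nat. close_mod1 (\<epsilon> / 2) (of_nat r * \<gamma>) z" for z
  proof -
    obtain h k where hk: "k > 0" "\<bar>of_int k * \<gamma> - of_int h - z\<bar> < \<epsilon> / 2"
      using sequence_of_fractional_parts_is_dense[OF assms(1), of "\<epsilon> / 2" z] assms(2) half_gt_zero by blast
    have k: "real (nat k) = real_of_int k"
      using hk(1) by simp
    have "\<bar>of_nat (nat k) * \<gamma> - z - of_int h\<bar> \<le> \<epsilon> / 2"
      using hk(2) unfolding k by linarith
    then show ?thesis
      unfolding close_mod1_def by blast
  qed
  then obtain r :: "real \<Rightarrow> nat" where r: "\<And>z. close_mod1 (\<epsilon> / 2) (of_nat (r z) * \<gamma>) z"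
    by metis
  define S where "S = (\<lambda>s::nat. s * (\<epsilon> / 2)) ` {..nat \<lfloor>1 / (\<epsilon> / 2)\<rfloor>}"
  have S: "\<exists>y\<in>S. close_mod1 (\<epsilon> / 2) y z" for z
  proof -
    define s where "s = nat \<lfloor>frac z / (\<epsilon> / 2)\<rfloor>"
    have nonneg: "0 \<le> frac z / (\<epsilon> / 2)"
      using assms by (simp add: frac_ge_0)
    have s: "real s \<le> frac z / (\<epsilon> / 2)" "frac z / (\<epsilon> / 2) < real s + 1"
      unfolding s_def using nonneg by (simp_all add: floor_less_cancel)
    have "s \<le> nat \<lfloor>1 / (\<epsilon> / 2)\<rfloor>"
      unfolding s_def using assms frac_lt_1[of z]
      by (intro nat_mono floor_mono divide_right_mono) auto
    moreover have "\<bar>s * (\<epsilon> / 2) - z - of_int (- \<lfloor>z\<rfloor>)\<bar> \<le> \<epsilon> / 2"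
      using s assms by (simp add: frac_def field_simps abs_le_iff)
    ultimately show ?thesis
      unfolding S_def close_mod1_def by blast
  qed
  have "finite S"
    by (simp add: S_def)
  show thesis
  proof
    fix z
    obtain y where y: "y \<in> S" "close_mod1 (\<epsilon> / 2) y z"
      using S by blast
    have "close_mod1 (\<epsilon> / 2 + \<epsilon> / 2) (of_nat (r y) * \<gamma>) z"
      using r y(2) by (rule close_mod1_trans)
    moreover have "r y \<le> Max (r ` S)"
      using \<open>finite S\<close> y by simp
    ultimately show "\<exists>k\<le>Max (r ` S). close_mod1 \<epsilon> (of_nat k * \<gamma>) z"
      by auto
  qed
qed

lemma nat_int_between:
  fixes f :: "nat \<Rightarrow> int"
  assumes step: "\<And>i. \<bar>f (Suc i) - f i\<bar> \<le> 1" and k: "f m \<le> k" "k \<le> f n"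
  shows "\<exists>i. f i = k"
proof (cases "m \<le> n")
  case True
  then show ?thesis
    using nat_intermed_int_val[of m n f k] assms by blast
next
  case False
  have "\<bar>- f (Suc i) - (- f i)\<bar> \<le> 1" for i
    using step[of i] by linarith
  then show ?thesis
    using nat_intermed_int_val[of n m "\<lambda>i. - f i" "- k"] False k by auto
qed

text \<open>Sliding a window of length m by one place changes the increment \<open>h\<close> of
  \<open>i\<close> over it by at most 1, so \<open>h\<close> attains K + 1 consecutive values. The
  differences m\<beta> + h\<gamma> thus contain a run of the rotation by \<gamma> that is long
  enough to be \<epsilon>-dense.\<close>

lemma unbalanced_differences_dense:
  fixes \<beta> \<gamma> :: real and i :: "nat \<Rightarrow> int"
  assumes "\<gamma> \<notin> \<rat>" and step: "\<And>n. i (Suc n) - i n \<in> {0, 1}"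
    and unbalanced: "\<And>K. \<exists>m n n'. K < i (n + m) - i n - (i (n' + m) - i n')"
    and "\<epsilon> > 0"
  shows "\<exists>p q. close_mod1 \<epsilon> ((real p * \<beta> + of_int (i p) * \<gamma>) - (real q * \<beta> + of_int (i q) * \<gamma>)) y"
proof -
  \<comment> \<open>Uniformity in \<open>z\<close> avoids a circle: the window is chosen after
    \<open>K\<close>, and the target shifts with the window.\<close>
  obtain K :: nat where K: "\<And>z. \<exists>r\<le>K. close_mod1 \<epsilon> (of_nat r * \<gamma>) z"
    using irrational_rotation_dense assms(1,4) by metis
  obtain m n n' where m: "int K < i (n + m) - i n - (i (n' + m) - i n')"
    using unbalanced by blast
  define h where "h n = i (n + m) - i n" for n
  obtain r where r: "r \<le> K" "close_mod1 \<epsilon> (of_nat r * \<gamma>) (y - (m * \<beta> + h n' * \<gamma>))"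
    using K by blast
  have "\<bar>h (Suc k) - h k\<bar> \<le> 1" for k
    using step[of k] step[of "k + m"] by (auto simp: h_def)
  then obtain q where q: "h q = h n' + int r"
    using nat_int_between[of h n' "h n' + int r" n] m r by (auto simp: h_def)
  have "close_mod1 \<epsilon> (of_nat r * \<gamma> + (m * \<beta> + h n' * \<gamma>)) y"
    using r(2) by (simp add: close_mod1_def algebra_simps)
  also have "of_nat r * \<gamma> + (m * \<beta> + h n' * \<gamma>) = m * \<beta> + of_int (h q) * \<gamma>"
    by (simp add: q algebra_simps)
  also have "\<dots> = (real (q + m) * \<beta> + i (q + m) * \<gamma>) - (real q * \<beta> + i q * \<gamma>)"
    by (simp add: h_def algebra_simps)
  finally show ?thesis
    by blast
qed

text \<open>The integer \<open>e\<close> absorbs the discrepancy between a strip point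
  \<open>j\<close> and \<open>i p - i q\<close>. Its range does not depend on \<rho>, so it costs
  only a constant factor in the count.\<close>

lemma balanced_differences_dense:
  fixes \<beta> \<gamma> :: real and i :: "nat \<Rightarrow> int"
  assumes indep: "\<And>(n::int) (j::int) (l::int). of_int n * \<beta> + of_int j * \<gamma> + of_int l = 0 \<Longrightarrow> n = 0"
    and "i 0 = 0"
    and balanced: "\<And>m n n'. i (n + m) - i n - (i (n' + m) - i n') \<le> K"
  shows "\<exists>c. 0 < c \<and> c \<le> 1 / 2 \<and> (\<forall>\<rho>>0. \<forall>y\<in>{0..c}. \<exists>p q. \<exists>e::int. \<bar>e\<bar> \<le> K + 1 \<and>
    close_mod1 \<rho> ((real p * \<beta> + of_int (i p) * \<gamma>) - (real q * \<beta> + of_int (i q) * \<gamma>) + of_int e * \<gamma>) y)"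
proof -
  \<comment> \<open>Balance compares the window of length \<open>n\<close> at \<open>m\<close> with
    the one at 0.\<close>
  have "\<bar>real_of_int (i (m + n)) - i m - i n\<bar> \<le> K" for m n
  proof -
    have "i (m + n) - i m - i n \<le> K"
      using balanced[of n m 0] unfolding add_0 \<open>i 0 = 0\<close> add.commute[of n m] by linarith
    moreover have "- (i (m + n) - i m - i n) \<le> K"
      using balanced[of 0 m n] unfolding add_0 \<open>i 0 = 0\<close> add.commute[of n m] by linarith
    ultimately show ?thesis
      by linarith
  qed
  then have "\<exists>\<theta>::real. \<forall>n. \<bar>i n - n * \<theta>\<bar> \<le> K"
    by (rule quasi_additive_slope)
  then obtain \<theta> :: real where \<theta>: "\<And>n. \<bar>i n - n * \<theta>\<bar> \<le> K"
    by blast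
  have "\<exists>c. 0 < c \<and> c \<le> 1 / 2 \<and> (\<forall>\<rho>>0. \<forall>y\<in>{0..c}.
      \<exists>(n::int) (j::int) (l::int). \<bar>n * \<beta> + j * \<gamma> + l - y\<bar> \<le> \<rho> \<and> \<bar>j - n * \<theta>\<bar> \<le> 1)"
    by (rule strip_dense) (fact indep)
  then obtain c where c: "0 < c" "c \<le> 1 / 2"
    "\<And>\<rho> y. \<rho> > 0 \<Longrightarrow> y \<in> {0..c} \<Longrightarrow>
      \<exists>(n::int) (j::int) (l::int). \<bar>n * \<beta> + j * \<gamma> + l - y\<bar> \<le> \<rho> \<and> \<bar>j - n * \<theta>\<bar> \<le> 1"
    by blast
  show ?thesis
  proof (intro exI[of _ c] conjI c(1,2) allI impI ballI)
    fix \<rho> y :: real assume "\<rho> > 0" "y \<in> {0..c}"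
    then obtain n j l :: int where v: "\<bar>n * \<beta> + j * \<gamma> + l - y\<bar> \<le> \<rho>" "\<bar>j - n * \<theta>\<bar> \<le> 1"
      using c(3) by blast
    \<comment> \<open>This covers both signs of \<open>n\<close>. One of \<open>p\<close>,
      \<open>q\<close> is 0 and \<open>i 0 = 0\<close>, so a single slope estimate with error
      \<open>K\<close> suffices.\<close>
    define p q where "p = nat n" and "q = nat (- n)"
    define e where "e = j - (i p - i q)"
    have n: "real_of_int n = real p - real q"
      by (simp add: p_def q_def)
    have "\<bar>(real_of_int (i p) - i q) - n * \<theta>\<bar> \<le> K"
    proof (cases "n \<ge> 0")
      case True
      then show ?thesis
        using \<theta>[of p] \<open>i 0 = 0\<close> by (simp add: p_def q_def)
    next
      case False
      then show ?thesis
        using \<theta>[of q] \<open>i 0 = 0\<close> by (simp add: p_def q_def abs_le_iff)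
    qed
    then have "\<bar>real_of_int e\<bar> \<le> K + 1"
      using v(2) by (simp add: e_def abs_le_iff)
    then have "\<bar>e\<bar> \<le> K + 1"
      by linarith
    moreover have "n * \<beta> + j * \<gamma> = (real p * \<beta> + of_int (i p) * \<gamma>) - (real q * \<beta> + of_int (i q) * \<gamma>) + e * \<gamma>"
      by (simp add: n e_def algebra_simps)
    then have "\<bar>(real p * \<beta> + of_int (i p) * \<gamma>) - (real q * \<beta> + of_int (i q) * \<gamma>) + e * \<gamma> - y - of_int (- l)\<bar> \<le> \<rho>"
      using v(1) by simp
    ultimately show "\<exists>p q. \<exists>e::int. \<bar>e\<bar> \<le> K + 1 \<and>
        close_mod1 \<rho> ((real p * \<beta> + of_int (i p) * \<gamma>) - (real q * \<beta> + of_int (i q) * \<gamma>) + of_int e * \<gamma>) y"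
      unfolding close_mod1_def by blast
  qed
qed

section \<open>Counting pairs of covering sets and the dimension bound\<close>

text \<open>Label each grid point y by the covering sets of \<open>x p\<close> and
  \<open>x q\<close> and by the correction \<open>e\<close>. Equal labels force 4\<rho>-closeness,
  hence equality, and there are \<open>k\<^sup>2 * (2 * B + 1)\<close> labels available. Covers are
  assumed prefix by prefix because only finite parts of \<open>x\<close> are known to have
  translates in the orbit set.\<close>

lemma covering_square_bound:
  fixes x :: "nat \<Rightarrow> real" and \<gamma> :: real and B :: int
  assumes c: "0 < c" "c \<le> 1 / 2" and \<rho>: "0 < \<rho>" "\<rho> \<le> 1 / 10"
    and dense: "\<And>y. y \<in> {0..c} \<Longrightarrow> \<exists>p q. \<exists>e::int. \<bar>e\<bar> \<le> B \<and> close_mod1 \<rho> (x p - x q + of_int e * \<gamma>) y"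
    and cover: "\<And>L. \<exists>f :: nat \<Rightarrow> 'a set. \<exists>C. finite C \<and> card C = k \<and> f ` {..L} \<subseteq> C \<and>
      (\<forall>j\<le>L. \<forall>j'\<le>L. f j = f j' \<longrightarrow> close_mod1 \<rho> (x j) (x j'))"
  shows "c / (5 * \<rho>) \<le> real (k\<^sup>2) * (2 * B + 1)"
proof -
  obtain p q e where pqe: "\<And>y. y \<in> {0..c} \<Longrightarrow> \<bar>e y\<bar> \<le> B"
    "\<And>y. y \<in> {0..c} \<Longrightarrow> close_mod1 \<rho> (x (p y) - x (q y) + of_int (e y) * \<gamma>) y"
    using dense by metis
  obtain Y where Y: "finite Y" "Y \<subseteq> {0..c}" "c / (5 * \<rho>) \<le> card Y"
    and sep: "\<And>y y'. y \<in> Y \<Longrightarrow> y' \<in> Y \<Longrightarrow> close_mod1 (4 * \<rho>) y y' \<Longrightarrow> y = y'"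
    using separated_grid[OF c \<rho>] by metis
  \<comment> \<open>The grid is finite, so one prefix contains all indices in use.\<close>
  define L where "L = Max (p ` Y \<union> q ` Y)"
  have L: "p y \<le> L" "q y \<le> L" if "y \<in> Y" for y
    using Y(1) that by (auto simp: L_def)
  obtain f :: "nat \<Rightarrow> 'a set" and C where C: "finite C" "card C = k" "f ` {..L} \<subseteq> C"
    and f: "\<And>j j'. j \<le> L \<Longrightarrow> j' \<le> L \<Longrightarrow> f j = f j' \<Longrightarrow> close_mod1 \<rho> (x j) (x j')"
    using cover[of L] by metis
  define g where "g y = (f (p y), f (q y), e y)" for y
  have "inj_on g Y"
  proof (rule inj_onI)
    fix y y' assume y: "y \<in> Y" "y' \<in> Y" and "g y = g y'"
    then have eq: "f (p y) = f (p y')" "f (q y) = f (q y')" "e y = e y'"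
      by (auto simp: g_def)
    have 1: "close_mod1 \<rho> (x (p y)) (x (p y'))"
      using f L y eq by blast
    have "close_mod1 \<rho> (x (q y')) (x (q y))"
      using f L y eq by metis
    then have 2: "close_mod1 \<rho> (- x (q y) + of_int (e y) * \<gamma>) (- x (q y') + of_int (e y') * \<gamma>)"
      by (simp add: close_mod1_def eq algebra_simps)
    have "close_mod1 \<rho> y (x (p y) + (- x (q y) + of_int (e y) * \<gamma>))"
      using close_mod1_sym[OF pqe(2)[of y]] y Y(2) by (auto simp: algebra_simps)
    then have "close_mod1 (\<rho> + (\<rho> + \<rho>)) y (x (p y') + (- x (q y') + of_int (e y') * \<gamma>))"
      using close_mod1_add[OF 1 2] by (rule close_mod1_trans)
    \<comment> \<open>One \<rho> each for approximating \<open>y\<close> and \<open>y'\<close>, and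
      one for each of the two shared covering sets.\<close>
    then have "close_mod1 (\<rho> + (\<rho> + \<rho>) + \<rho>) y y'"
      by (rule close_mod1_trans) (use pqe(2)[of y'] y Y(2) in \<open>auto simp: algebra_simps\<close>)
    then show "y = y'"
      using sep[OF y] by simp
  qed
  moreover have "g ` Y \<subseteq> C \<times> C \<times> {- B..B}"
  proof (rule image_subsetI)
    fix y assume "y \<in> Y"
    then have "f (p y) \<in> C" "f (q y) \<in> C" "\<bar>e y\<bar> \<le> B"
      using C(3) L[of y] pqe(1)[of y] Y(2) by (auto simp: image_subset_iff)
    then show "g y \<in> C \<times> C \<times> {- B..B}"
      by (simp add: g_def abs_le_iff)
  qed
  ultimately have "card Y \<le> card (C \<times> C \<times> {- B..B})"
    using C(1) by (intro card_inj_on_le) auto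
  also have "\<dots> = k\<^sup>2 * nat (2 * B + 1)"
    by (simp add: card_cartesian_product C power2_eq_square algebra_simps)
  finally have "real (card Y) \<le> real (k\<^sup>2) * real (nat (2 * B + 1))"
    by (metis of_nat_le_iff of_nat_mult)
  moreover have "0 \<le> B"
    using pqe(1)[of 0] c by simp
  ultimately show ?thesis
    using Y(3) by simp
qed

text \<open>Logarithms turn the bound into 2 ln k \<ge> ln A + ln (1/\<rho>); after division by 2 ln
  (1/\<rho>) the lower bound \<open>F\<close> tends to 1/2.\<close>

lemma lower_box_dim_ge_half:
  assumes "A > 0" "\<rho>\<^sub>0 > 0"
    and bound: "\<And>\<rho>. 0 < \<rho> \<Longrightarrow> \<rho> \<le> \<rho>\<^sub>0 \<Longrightarrow> A / \<rho> \<le> (real (covering_number E \<rho>))\<^sup>2"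
  shows "1 / 2 \<le> lower_box_dim E"
proof -
  define F where "F \<rho> = 1 / 2 + ln A / 2 / ln (1 / \<rho>)" for \<rho> :: real
  have "filterlim (\<lambda>\<rho>::real. ln (1 / \<rho>)) at_top (at_right 0)"
    by (rule filterlim_compose[OF ln_at_top])
      (simp add: filterlim_inverse_at_top_right flip: inverse_eq_divide)
  then have "((\<lambda>\<rho>. ln A / 2 / ln (1 / \<rho>)) \<longlongrightarrow> 0) (at_right 0)"
    by (rule real_tendsto_divide_at_top[OF tendsto_const])
  then have "(F \<longlongrightarrow> 1 / 2 + 0) (at_right 0)"
    unfolding F_def by (intro tendsto_add tendsto_const)
  then have "((\<lambda>\<rho>. ereal (F \<rho>)) \<longlongrightarrow> ereal (1 / 2)) (at_right 0)"
    by simp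
  then have "ereal (1 / 2) = Liminf (at_right 0) (\<lambda>\<rho>. ereal (F \<rho>))"
    by (intro lim_imp_Liminf[symmetric]) auto
  also have "\<dots> \<le> lower_box_dim E"
    unfolding lower_box_dim_def
  proof (rule Liminf_mono)
    have "eventually (\<lambda>\<rho>::real. \<rho> \<in> {0<..<min \<rho>\<^sub>0 1}) (at_right 0)"
      using assms by (intro eventually_at_right_real) simp
    then show "\<forall>\<^sub>F \<rho> in at_right 0. ereal (F \<rho>) \<le> ereal (ln (real (covering_number E \<rho>)) / ln (1 / \<rho>))"
    proof eventually_elim
      case (elim \<rho>)
      let ?k = "real (covering_number E \<rho>)"
      have le: "A / \<rho> \<le> ?k\<^sup>2"
        using bound elim by simp
      have pos: "0 < A / \<rho>" "0 < ln (1 / \<rho>)"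
        using assms(1) elim by simp_all
      \<comment> \<open>The positive lower bound on \<open>?k\<^sup>2\<close> rules out the default
        value of \<open>ln\<close> at 0.\<close>
      then have "?k > 0"
        using le by (cases "?k = 0") auto
      have "ln A + ln (1 / \<rho>) = ln (A / \<rho>)"
        using assms(1) elim by (simp add: ln_div)
      also have "\<dots> \<le> ln (?k\<^sup>2)"
        using le pos by (meson ln_mono)
      also have "\<dots> = 2 * ln ?k"
        using \<open>?k > 0\<close> by (simp add: ln_realpow)
      finally have "(ln A + ln (1 / \<rho>)) / (2 * ln (1 / \<rho>)) \<le> 2 * ln ?k / (2 * ln (1 / \<rho>))"
        using pos(2) by (intro divide_right_mono) auto
      moreover have "F \<rho> = (ln A + ln (1 / \<rho>)) / (2 * ln (1 / \<rho>))"
        using pos(2) unfolding F_def add_divide_distrib by simp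
      ultimately show ?case
        by simp
    qed
  qed
  finally show ?thesis
    by (simp add: one_ereal_def)
qed

section \<open>Orbits on the circle and integer relations\<close>

lemma to_circle_add: "to_circle (x + y) = to_circle x + to_circle y"
  by transfer simp

lemma to_circle_diff: "to_circle (x - y) = to_circle x - to_circle y"
  by transfer simp

lemma to_circle_zero: "to_circle 0 = 0"
  by transfer simp

text \<open>A step other than \<alpha> must be \<beta>, so each step contributes \<beta> and each
  letter \<alpha> an additional \<alpha> - \<beta>.\<close>

lemma ab_orbit_displacement:
  assumes orbit: "ab_orbit \<alpha> \<beta> t" and "n \<ge> 1"
    and w: "\<And>j. j < L \<Longrightarrow> (t (Suc (n + j)) - t (n + j) = to_circle \<alpha>) = v j"
    and "j \<le> L"
  shows "t (n + j) = t n + to_circle (j * \<beta> + of_int (\<Sum>i<j. of_bool (v i)) * (\<alpha> - \<beta>))"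
  using \<open>j \<le> L\<close>
proof (induction j)
  case (Suc j)
  have "t (Suc (n + j)) - t (n + j) = to_circle (if v j then \<alpha> else \<beta>)"
    using orbit[unfolded ab_orbit_def, rule_format, of "n + j"] w[of j] Suc.prems \<open>n \<ge> 1\<close>
    by (cases "v j") auto
  then have "t (n + Suc j) = to_circle (if v j then \<alpha> else \<beta>) + t (n + j)"
    by (simp add: algebra_simps)
  also have "\<dots> = t n + to_circle ((j * \<beta> + of_int (\<Sum>i<j. of_bool (v i)) * (\<alpha> - \<beta>)) + (if v j then \<alpha> else \<beta>))"
    unfolding to_circle_add[of "_ + _" "if v j then \<alpha> else \<beta>"]
    using Suc by (simp add: algebra_simps)
  also have "(j * \<beta> + of_int (\<Sum>i<j. of_bool (v i)) * (\<alpha> - \<beta>)) + (if v j then \<alpha> else \<beta>)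
      = Suc j * \<beta> + of_int (\<Sum>i<Suc j. of_bool (v i)) * (\<alpha> - \<beta>)"
    by (simp add: algebra_simps)
  finally show ?case .
qed (simp add: to_circle_zero)

text \<open>The translation \<open>a\<close> cancels in the difference, and the lifts
  \<open>z\<close>, \<open>z'\<close> share a real interval of length \<rho>.\<close>

lemma circle_interval_close:
  assumes "a + to_circle x \<in> circle_interval b \<rho>" "a + to_circle x' \<in> circle_interval b \<rho>"
  shows "close_mod1 \<rho> x x'"
proof -
  obtain z z' where z: "a + to_circle x = to_circle z" "a + to_circle x' = to_circle z'"
    "z \<in> {b..b + \<rho>}" "z' \<in> {b..b + \<rho>}"
    using assms by (auto simp: circle_interval_def)
  have "to_circle (x - x') = (a + to_circle x) - (a + to_circle x')"
    by (simp add: to_circle_diff)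
  then have "to_circle (x - x') = to_circle (z - z')"
    by (simp add: z to_circle_diff)
  then obtain l where "x - x' - (z - z') = of_int l"
    by (auto simp: to_circle_eq_iff Ints_def)
  then have "\<bar>x - x' - of_int l\<bar> \<le> \<rho>"
    using z(3,4) by (simp add: abs_le_iff)
  then show ?thesis
    unfolding close_mod1_def by blast
qed

lemma integer_relation_trivial:
  assumes "distinct [1, \<alpha>, \<beta>]"
    and "module.independent (\<lambda>q :: rat. (*) (of_rat q)) {1, \<alpha>, \<beta> :: real}"
    and "of_int a + of_int b * \<alpha> + of_int c * \<beta> = 0"
  shows "a = 0 \<and> b = 0 \<and> c = 0"
proof -
  interpret module "\<lambda>q :: rat. (*) (of_rat q :: real)"
    by unfold_locales (auto simp: of_rat_add of_rat_mult algebra_simps)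
  define u where "u x = (if x = 1 then of_int a else if x = \<alpha> then of_int b else of_int c :: rat)" for x :: real
  have "(\<Sum>v\<in>{1, \<alpha>, \<beta>}. of_rat (u v) * v) = 0"
    using assms(1,3) by (auto simp: u_def)
  then have "u v = 0" if "v \<in> {1, \<alpha>, \<beta>}" for v
    using independentD[OF assms(2), of "{1, \<alpha>, \<beta>}" u v] that by simp
  from this[of 1] this[of \<alpha>] this[of \<beta>] show ?thesis
    using assms(1) by (auto simp: u_def)
qed

theorem proposition1p3:
  fixes \<alpha> \<beta> :: real and t :: "nat \<Rightarrow> circle" and J :: "nat set"
  assumes "distinct [1, \<alpha>, \<beta>]"
    and "module.independent (\<lambda>q :: rat. (*) (of_rat q)) {1, \<alpha>, \<beta>}"
    and "ab_orbit \<alpha> \<beta> t"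
    and "J \<subseteq> {1..}"
    and "lower_density J = 0"
  shows "lower_box_dim (t ` ({1..} - J)) \<ge> 1 / 2"
proof -
  define \<gamma> where "\<gamma> = \<alpha> - \<beta>"
  \<comment> \<open>The relation reads l + j\<alpha> + (n - j)\<beta> = 0.\<close>
  have indep: "n = 0 \<and> j = 0" if "n * \<beta> + j * \<gamma> + l = 0" for n j l :: int
    using integer_relation_trivial[OF assms(1,2), of l j "n - j"] that
    by (simp add: \<gamma>_def algebra_simps)
  have irrational: "\<gamma> \<notin> \<rat>"
  proof
    assume "\<gamma> \<in> \<rat>"
    then obtain a b :: int where "b > 0" "\<gamma> = a / b"
      by (auto elim: Rats_cases')
    then show False
      using indep[of 0 b "- a"] by simp
  qed
  have "\<exists>n\<ge>1. {n..n + L} \<inter> J = {}" for L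
    using lower_density_zero_gap[OF assms(5)] by blast
  then obtain s where s: "\<And>L. s L \<ge> 1" "\<And>L. {s L..s L + L} \<inter> J = {}"
    by metis
  \<comment> \<open>Each prefix of the limit word \<open>v\<close> is read from the start of some
    gap block at \<open>s M\<close> that is at least as long, so the corresponding orbit points have
    indices outside J.\<close>
  obtain v where v: "\<And>L. \<exists>M\<ge>L. \<forall>j<L. (t (Suc (s M + j)) - t (s M + j) = to_circle \<alpha>) = v j"
    using binary_sequences_cluster_point[of "\<lambda>M j. t (Suc (s M + j)) - t (s M + j) = to_circle \<alpha>"]
    by blast
  define i where "i n = (\<Sum>j<n. of_bool (v j) :: int)" for n :: nat
  define x where "x n = n * \<beta> + i n * \<gamma>" for n :: nat
  let ?E = "t ` ({1..} - J)"
  have prefix: "\<exists>a. \<forall>j\<le>L. a + to_circle (x j) \<in> ?E" for L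
  proof -
    obtain M where M: "M \<ge> L" "\<And>j. j < L \<Longrightarrow> (t (Suc (s M + j)) - t (s M + j) = to_circle \<alpha>) = v j"
      using v by metis
    have "t (s M) + to_circle (x j) \<in> ?E" if "j \<le> L" for j
    proof -
      have "s M + j \<in> {s M..s M + M}"
        using M(1) that by simp
      then have "s M + j \<in> {1..} - J"
        using s[of M] by fastforce
      moreover have "t (s M) + to_circle (x j) = t (s M + j)"
        using ab_orbit_displacement[OF assms(3) s(1) M(2) that] by (simp add: x_def i_def \<gamma>_def)
      ultimately show ?thesis
        by blast
    qed
    then show ?thesis
      by blast
  qed
  \<comment> \<open>\<open>f j\<close> picks a covering interval for the translate of
    \<open>x j\<close>; the translation depends on \<open>L\<close>, but the number of intervals
    does not.\<close>
  have cover: "\<exists>f :: nat \<Rightarrow> circle set. \<exists>C. finite C \<and> card C = covering_number ?E \<rho> \<and> f ` {..L} \<subseteq> C \<and>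
      (\<forall>j\<le>L. \<forall>j'\<le>L. f j = f j' \<longrightarrow> close_mod1 \<rho> (x j) (x j'))" if \<rho>: "\<rho> > 0" for \<rho> L
  proof -
    obtain C where C: "finite C" "card C = covering_number ?E \<rho>"
      "C \<subseteq> range (\<lambda>a. circle_interval a \<rho>)" "?E \<subseteq> \<Union>C"
      using covering_number_witness[OF \<rho>] by metis
    obtain a where a: "\<And>j. j \<le> L \<Longrightarrow> a + to_circle (x j) \<in> ?E"
      using prefix by blast
    have "\<exists>I\<in>C. a + to_circle (x j) \<in> I" if "j \<le> L" for j
      using a[OF that] C(4) by blast
    then obtain f where f: "\<And>j. j \<le> L \<Longrightarrow> f j \<in> C" "\<And>j. j \<le> L \<Longrightarrow> a + to_circle (x j) \<in> f j"
      by metis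
    have "close_mod1 \<rho> (x j) (x j')" if "j \<le> L" "j' \<le> L" "f j = f j'" for j j'
    proof -
      obtain b where "f j = circle_interval b \<rho>"
        using f(1) C(3) \<open>j \<le> L\<close> by blast
      then show ?thesis
        using f(2) that circle_interval_close by metis
    qed
    then show ?thesis
      using C(1,2) f(1) by (intro exI[of _ f] exI[of _ C]) auto
  qed
  have "\<exists>c. \<exists>B::int. 0 < c \<and> c \<le> 1 / 2 \<and> (\<forall>\<rho>>0. \<forall>y\<in>{0..c}.
      \<exists>p q. \<exists>e::int. \<bar>e\<bar> \<le> B \<and> close_mod1 \<rho> (x p - x q + of_int e * \<gamma>) y)"
  proof (cases "\<exists>K. \<forall>m n n'. i (n + m) - i n - (i (n' + m) - i n') \<le> K")
    case True
    then obtain K where K: "\<And>m n n'. i (n + m) - i n - (i (n' + m) - i n') \<le> K"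
      by blast
    have ind: "n = 0" if "n * \<beta> + j * \<gamma> + l = 0" for n j l :: int
      using indep[OF that] ..
    have "i 0 = 0"
      by (simp add: i_def)
    show ?thesis
      unfolding x_def
      by (subst ex_comm, rule exI[of _ "K + 1"])
        (rule balanced_differences_dense[OF ind \<open>i 0 = 0\<close> K])
  next
    case False
    have "i (Suc n) - i n \<in> {0, 1}" for n
      by (simp add: i_def)
    then have "\<exists>p q. close_mod1 \<rho> (x p - x q) y" if "\<rho> > 0" for \<rho> y
      unfolding x_def using unbalanced_differences_dense[OF irrational _ _ that, of i] False
      by (meson not_le)
    \<comment> \<open>Unbalanced words need no correction, so B = 0; every real \<open>y\<close> is
      reached, so c = 1/2 is allowed.\<close>
    then show ?thesis
      by (intro exI[of _ "1/2"] exI[of _ "0"]) force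
  qed
  then obtain c and B :: int where c: "0 < c" "c \<le> 1 / 2"
    and dense: "\<And>\<rho> y. \<rho> > 0 \<Longrightarrow> y \<in> {0..c} \<Longrightarrow>
      \<exists>p q. \<exists>e::int. \<bar>e\<bar> \<le> B \<and> close_mod1 \<rho> (x p - x q + of_int e * \<gamma>) y"
    by metis
  have "B \<ge> 0"
    using dense[of 1 0] c by force
  show ?thesis
  proof (rule lower_box_dim_ge_half)
    \<comment> \<open>The constant comes from dividing the pair count by 2B + 1, and 1/10 is the
      range of \<rho> in which the grid is separated.\<close>
    show "0 < c / (5 * (2 * B + 1))" "0 < (1 / 10 :: real)"
      using c \<open>B \<ge> 0\<close> by simp_all
    fix \<rho> :: real assume \<rho>: "0 < \<rho>" "\<rho> \<le> 1 / 10"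
    have "c / (5 * \<rho>) \<le> real ((covering_number ?E \<rho>)\<^sup>2) * (2 * B + 1)"
      using covering_square_bound[OF c \<rho> dense[OF \<rho>(1)] cover[OF \<rho>(1)]] .
    then have "c / (5 * \<rho>) / (2 * B + 1) \<le> (real (covering_number ?E \<rho>))\<^sup>2"
      using \<open>B \<ge> 0\<close> by (subst pos_divide_le_eq) simp_all
    then show "c / (5 * (2 * B + 1)) / \<rho> \<le> (real (covering_number ?E \<rho>))\<^sup>2"
      by (simp add: mult_ac)
  qed
qed

end
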